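(* Let $\{X_n\}_{n\ge 0}$ be a two-type branching process with immigration (with the notation fixed in the context) such that $f(\mathbf 0)=\mathbf 0$, the mean matrix $M$ is positively regular, and its maximal eigenvalue satisfies $\rho>1$. Let $$Y_n=\rho^{-n}\Big(\boldsymbol u\cdot X_n-\frac{\rho^{n+1}-1}{\rho-1}(\boldsymbol u\cdot\boldsymbol\lambda)\Big),\qquad n\ge0.$$ Assume that $E_i\big(e^{\theta_0(\mathbf 1\cdot X_1)}\big)<\infty$ for some $\theta_0>0$ and $i=1,2$. Then there is $\theta_0^\star>0$ such that, for $i=1,2$, $$\sup_n E_i\big(e^{\theta_0^\star Y_n}\big)<\infty.$$
   Context: $\mathbb N=\{0,1,2,\dots\}$, $\mathbf 1=(1,1)$, $\mathbf 0=(0,0)$, $e_1=(1,0)$, $e_2=(0,1)$; vectors are row vectors and $\cdot$ is the Euclidean inner product. $\{Z_n\}_{n\ge0}$, $Z_n=(Z_n^{(1)},Z_n^{(2)})$, is a two-type Galton–Watson branching process: each particle of type $i$ independently produces, in the next generation, a random vector of offspring with law $P_i(j_1,j_2)=P(Z_1=(j_1,j_2)\mid Z_0=e_i)$. Its offspring generating functions are $f^{(i)}(\boldsymbol s)=\sum_{\boldsymbol j\in\mathbb N^2}P_i(j_1,j_2)s_1^{j_1}s_2^{j_2}$, $i=1,2$, $\boldsymbol s\in[0,1]^2$, and $f=(f^{(1)},f^{(2)})$. $I_1,I_2,\dots$ are i.i.d. $\mathbb N^2$-valued immigration vectors, independent of the reproduction, with mean $\boldsymbol\lambda=E(I_1)=(\lambda_1,\lambda_2)$.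 The process with immigration is $X_0=Z_0$, $X_n=Z_n+U_n^{(1)}+\cdots+U_n^{(n)}$ for $n\ge1$, where $U_n^{(k)}$ is the vector of numbers of descendants, in generation $n$, of the $k$-th immigration $I_k$ (so $U_n^{(n)}=I_n$); all particles reproduce independently with the same offspring laws. Equivalently, given $X_n=\boldsymbol j$, $X_{n+1}$ is the sum of the offspring vectors of the $j_1$ particles of type 1 and the $j_2$ particles of type 2 plus the independent vector $I_{n+1}$. $P_i$ and $E_i$ denote probability and expectation given $X_0=e_i$. $M=(m_{ij})$ with $m_{ij}=\partial f^{(i)}/\partial s_j(\mathbf 1^-)$ is the mean matrix (with finite entries). Positively regular means that some power of $M$ has all entries strictly positive; $\rho$ is then the maximal (Perron–Frobenius) eigenvalue of $M$, with strictly positive left eigenvector $\boldsymbol v$ and right eigenvector $\boldsymbol u$ normalized by $\boldsymbol v\cdot\boldsymbol u=1$, $\boldsymbol u\cdot\mathbf 1=1$. *)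

theory Defs
  imports "HOL-Probability.Probability"
begin

text \<open>
  Particle types are the elements of the two-element index type \<^typ>\<open>2\<close>, so that vectors of particle
  numbers have type \<^typ>\<open>nat ^ 2\<close>; in \<^typ>\<open>real ^ 2\<close> the vector of ones is \<^term>\<open>1\<close>. Beware that
  \<open>*\<close> and \<open>^\<close> on vectors and matrices are componentwise.
\<close>

definition real_vec :: "nat ^ 2 \<Rightarrow> real ^ 2" where
  "real_vec j = (\<chi> i. real (j $ i))"

definition unit_vec :: "2 \<Rightarrow> nat ^ 2" where
  "unit_vec i = axis i 1"

subsection \<open>Offspring laws\<close>

definition offspring_gf :: "(2 \<Rightarrow> (nat ^ 2) pmf) \<Rightarrow> real ^ 2 \<Rightarrow> real ^ 2" where
  "offspring_gf P s = (\<chi> i. \<Sum>\<^sub>\<infinity>j. pmf (P i) j * s $ 1 ^ (j $ 1) * s $ 2 ^ (j $ 2))"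

text \<open>
  The generating functions live on the unit square, so the partial derivatives at \<^term>\<open>1\<close> are
  one-sided. Existence as real derivatives expresses that the entries of the mean matrix are finite.
\<close>

definition has_mean_matrix :: "(2 \<Rightarrow> (nat ^ 2) pmf) \<Rightarrow> real ^ 2 ^ 2 \<Rightarrow> bool" where
  "has_mean_matrix P M \<longleftrightarrow>
     (\<forall>i j. ((\<lambda>x. offspring_gf P (\<chi> k. if k = j then x else 1) $ i)
              has_real_derivative M $ i $ j) (at 1 within {0..1}))"

primrec mat_power :: "real ^ 2 ^ 2 \<Rightarrow> nat \<Rightarrow> real ^ 2 ^ 2" where
  "mat_power A 0 = mat 1"
| "mat_power A (Suc n) = A ** mat_power A n"

definition positively_regular :: "real ^ 2 ^ 2 \<Rightarrow> bool" where
  "positively_regular A \<longleftrightarrow> (\<exists>n. \<forall>i j. 0 < mat_power A n $ i $ j)"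

definition eigenvalues :: "real ^ 2 ^ 2 \<Rightarrow> complex set" where
  "eigenvalues A = {z. \<exists>x. x \<noteq> 0 \<and> map_matrix complex_of_real A *v x = z *s x}"

definition maximal_eigenvalue :: "real ^ 2 ^ 2 \<Rightarrow> real \<Rightarrow> bool" where
  "maximal_eigenvalue A \<rho> \<longleftrightarrow>
     complex_of_real \<rho> \<in> eigenvalues A \<and> (\<forall>z \<in> eigenvalues A. cmod z \<le> \<rho>)"

definition perron_eigenvectors ::
  "real ^ 2 ^ 2 \<Rightarrow> real \<Rightarrow> real ^ 2 \<Rightarrow> real ^ 2 \<Rightarrow> bool" where
  "perron_eigenvectors A \<rho> v u \<longleftrightarrow>
     (\<forall>i. 0 < v $ i) \<and> (\<forall>i. 0 < u $ i) \<and>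
     v v* A = \<rho> *s v \<and> A *v u = \<rho> *s u \<and>
     v \<bullet> u = 1 \<and> u \<bullet> 1 = 1"

subsection \<open>The branching process with immigration\<close>

text \<open>
  Particles are grouped into families: family \<open>0\<close> descends from the initial particle, family
  \<open>k \<ge> 1\<close> from the \<open>k\<close>-th immigration \<open>I k\<close>. The random vector \<open>\<xi> k n i m\<close> is the offspring of
  the \<open>m\<close>-th particle of type \<open>i\<close> in generation \<open>n\<close> of family \<open>k\<close>. The value \<open>I 0\<close> plays no role.
\<close>

locale branching_with_immigration = prob_space \<Omega>
  for \<Omega> :: "'a measure"
    and P :: "2 \<Rightarrow> (nat ^ 2) pmf"
    and \<xi> :: "nat \<Rightarrow> nat \<Rightarrow> 2 \<Rightarrow> nat \<Rightarrow> 'a \<Rightarrow> nat ^ 2"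
    and I :: "nat \<Rightarrow> 'a \<Rightarrow> nat ^ 2" +
  assumes independent:
      "indep_vars (\<lambda>_. count_space UNIV)
         (case_sum (\<lambda>(k, n, i, m). \<xi> k n i m) I) (UNIV <+> {1..})"
    and offspring_law: "\<And>k n i m. distr \<Omega> (count_space UNIV) (\<xi> k n i m) = measure_pmf (P i)"
    and immigration_law:
      "\<And>k. 1 \<le> k \<Longrightarrow> distr \<Omega> (count_space UNIV) (I k) = distr \<Omega> (count_space UNIV) (I 1)"

primrec progeny ::
  "(nat \<Rightarrow> 2 \<Rightarrow> nat \<Rightarrow> 'a \<Rightarrow> nat ^ 2) \<Rightarrow> ('a \<Rightarrow> nat ^ 2) \<Rightarrow> nat \<Rightarrow> 'a \<Rightarrow> nat ^ 2" where
  "progeny \<zeta> a 0 \<omega> = a \<omega>"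
| "progeny \<zeta> a (Suc n) \<omega> = (\<Sum>i\<in>UNIV. \<Sum>m<progeny \<zeta> a n \<omega> $ i. \<zeta> n i m \<omega>)"

text \<open>
  \<open>branching_Z \<xi> z\<close> and \<open>immigration_X \<xi> I z\<close> start from the deterministic vector \<open>z\<close>, so that an
  expectation given that the initial state is \<open>z\<close> is an expectation under \<open>\<Omega>\<close> for these processes.
\<close>

definition branching_Z ::
  "(nat \<Rightarrow> nat \<Rightarrow> 2 \<Rightarrow> nat \<Rightarrow> 'a \<Rightarrow> nat ^ 2) \<Rightarrow> nat ^ 2 \<Rightarrow> nat \<Rightarrow> 'a \<Rightarrow> nat ^ 2" where
  "branching_Z \<xi> z n = progeny (\<xi> 0) (\<lambda>_. z) n"

text \<open>For \<open>n \<ge> k\<close>: the descendants in generation \<open>n\<close> of the \<open>k\<close>-th immigration.\<close>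

definition immigrant_U ::
  "(nat \<Rightarrow> nat \<Rightarrow> 2 \<Rightarrow> nat \<Rightarrow> 'a \<Rightarrow> nat ^ 2) \<Rightarrow> (nat \<Rightarrow> 'a \<Rightarrow> nat ^ 2) \<Rightarrow>
     nat \<Rightarrow> nat \<Rightarrow> 'a \<Rightarrow> nat ^ 2" where
  "immigrant_U \<xi> I k n = progeny (\<lambda>r. \<xi> k (k + r)) (I k) (n - k)"

definition immigration_X ::
  "(nat \<Rightarrow> nat \<Rightarrow> 2 \<Rightarrow> nat \<Rightarrow> 'a \<Rightarrow> nat ^ 2) \<Rightarrow> (nat \<Rightarrow> 'a \<Rightarrow> nat ^ 2) \<Rightarrow>
     nat ^ 2 \<Rightarrow> nat \<Rightarrow> 'a \<Rightarrow> nat ^ 2" where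
  "immigration_X \<xi> I z n \<omega> = branching_Z \<xi> z n \<omega> + (\<Sum>k = 1..n. immigrant_U \<xi> I k n \<omega>)"

text \<open>
  Only meaningful if \<open>I 1\<close> is integrable; this holds whenever some positive exponential moment of
  the total population in generation \<open>1\<close> is finite.
\<close>

definition immigration_mean :: "'a measure \<Rightarrow> (nat \<Rightarrow> 'a \<Rightarrow> nat ^ 2) \<Rightarrow> real ^ 2" where
  "immigration_mean \<Omega> I = (\<chi> i. \<integral>\<omega>. real (I 1 \<omega> $ i) \<partial>\<Omega>)"

definition centered_Y ::
  "real \<Rightarrow> real ^ 2 \<Rightarrow> real ^ 2 \<Rightarrow> (nat \<Rightarrow> 'a \<Rightarrow> nat ^ 2) \<Rightarrow> nat \<Rightarrow> 'a \<Rightarrow> real" where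
  "centered_Y \<rho> u lam X n \<omega> =
     (1 / \<rho> ^ n) * (u \<bullet> real_vec (X n \<omega>) - (\<rho> ^ (n + 1) - 1) / (\<rho> - 1) * (u \<bullet> lam))"

end

theory Submission
  imports Defs
begin

text \<open>
  Since \<open>u\<close> is a right eigenvector, a second-order expansion of the exponential moment gives
  \<open>E\<^sub>i (exp (t (u \<bullet> Z\<^sub>1))) \<le> exp (\<rho> (t + C t\<^sup>2) u\<^sub>i)\<close> for small \<open>t\<close>. The function \<open>\<psi> s = s + B s\<^sup>2\<close>
  satisfies \<open>\<rho> (\<psi> s + C (\<psi> s)\<^sup>2) \<le> \<psi> (\<rho> s)\<close> for small \<open>s\<close>, so going back \<open>r\<close> generations in a family
  replaces the exponent \<open>\<psi> s\<close> by at most \<open>\<psi> (\<rho>\<^sup>r s)\<close>. With \<open>s = \<theta> / \<rho>\<^sup>n\<close> the \<open>k\<close>-th immigration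
  contributes at most \<open>E (exp (\<psi> (\<theta> / \<rho>\<^sup>k) (u \<bullet> I\<^sub>1)))\<close>, which is \<open>exp (O(\<rho>\<^sup>-\<^sup>k))\<close>, and the product over
  the independent families is bounded in \<open>n\<close>. The term subtracted in the definition of \<open>Y\<^sub>n\<close> is
  nonnegative and can be dropped.
\<close>

subsection \<open>Exponential inequalities and offspring means\<close>

text \<open>Convexity of \<open>exp\<close>: \<open>t * x\<close> lies on the segment from
  \<open>0\<close> to \<open>c * x\<close>, with weight \<open>t / c\<close> at the far end. The
  sign of \<open>x\<close> is arbitrary.\<close>

lemma exp_mult_le_linear:
  fixes t c x :: real
  assumes "0 \<le> t" "t \<le> c" "0 < c"
  shows "exp (t * x) \<le> 1 + t / c * exp (c * x)"
proof -
  have "exp ((1 - t / c) *\<^sub>R 0 + (t / c) *\<^sub>R (c * x)) \<le> (1 - t / c) * exp 0 + t / c * exp (c * x)"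
    using assms by (intro convex_onD[OF exp_convex]) auto
  then have "exp (t * x) \<le> 1 - t / c + t / c * exp (c * x)"
    using assms by simp
  moreover have "0 \<le> t / c"
    using assms by simp
  ultimately show ?thesis
    by linarith
qed

text \<open>In the exponential series, passing from \<open>c\<close> to \<open>t\<close> shrinks
  every term of degree at least two by the factor \<open>(t / c)\<^sup>2\<close> or more;
  \<open>0 \<le> x\<close> makes the comparison termwise. The linear term stays exact, so that the
  eigenvector equation can later be applied to its mean.\<close>

lemma exp_mult_le_quadratic:
  fixes t c x :: real
  assumes "0 \<le> t" "t \<le> c" "0 < c" "0 \<le> x"
  shows "exp (t * x) \<le> 1 + t * x + (t / c)\<^sup>2 * exp (c * x)"
proof -
  have summable: "summable (\<lambda>n. inverse (fact (n + 2)) * y ^ (n + 2))" for y :: real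
    using summable_exp[of y] summable_iff_shift[of "\<lambda>n. inverse (fact n) * y ^ n" 2] by simp
  have "inverse (fact (n + 2)) * (t * x) ^ (n + 2)
      \<le> (t / c)\<^sup>2 * (inverse (fact (n + 2)) * (c * x) ^ (n + 2))" for n
  proof -
    have "(t / c) ^ (n + 2) \<le> (t / c)\<^sup>2"
      using assms by (intro power_decreasing) auto
    then have "(t / c) ^ (n + 2) * (c * x) ^ (n + 2) \<le> (t / c)\<^sup>2 * (c * x) ^ (n + 2)"
      using assms by (intro mult_right_mono) auto
    then have "(t * x) ^ (n + 2) \<le> (t / c)\<^sup>2 * (c * x) ^ (n + 2)"
      unfolding power_mult_distrib[symmetric] using assms by (simp del: power_Suc)
    then have "inverse (fact (n + 2)) * (t * x) ^ (n + 2)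
        \<le> inverse (fact (n + 2)) * ((t / c)\<^sup>2 * (c * x) ^ (n + 2))"
      by (intro mult_left_mono) auto
    then show ?thesis
      by (simp only: mult_ac)
  qed
  then have "(\<Sum>n. inverse (fact (n + 2)) * (t * x) ^ (n + 2))
      \<le> (t / c)\<^sup>2 * (\<Sum>n. inverse (fact (n + 2)) * (c * x) ^ (n + 2))"
    using summable by (subst suminf_mult[symmetric]) (auto intro!: suminf_le summable_mult simp del: power_Suc)
  also have "\<dots> \<le> (t / c)\<^sup>2 * exp (c * x)"
    using assms by (intro mult_left_mono) (auto simp: exp_first_two_terms[of "c * x"])
  finally show ?thesis
    using exp_first_two_terms[of "t * x"] by simp
qed

lemma inner_real_vec: "u \<bullet> real_vec x = (\<Sum>i\<in>UNIV. u $ i * real (x $ i))"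
  by (simp add: inner_vec_def real_vec_def)

lemma inner_real_vec_nonneg: "(\<And>i. 0 \<le> u $ i) \<Longrightarrow> 0 \<le> u \<bullet> real_vec x"
  by (auto simp: inner_real_vec intro!: sum_nonneg)

lemma inner_real_vec_mono: "(\<And>i. u $ i \<le> w $ i) \<Longrightarrow> u \<bullet> real_vec x \<le> w \<bullet> real_vec x"
  by (auto simp: inner_real_vec intro!: sum_mono mult_right_mono)

lemma real_vec_add: "real_vec (x + y) = real_vec x + real_vec y"
  by (simp add: real_vec_def vec_eq_iff)

lemma real_vec_sum: "real_vec (\<Sum>k\<in>A. f k) = (\<Sum>k\<in>A. real_vec (f k))"
  by (simp add: real_vec_def vec_eq_iff)

lemma inner_real_vec_unit_vec: "u \<bullet> real_vec (unit_vec i) = u $ i"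
  by (simp add: inner_real_vec unit_vec_def axis_def if_distrib cong: if_cong)

text \<open>On a segment parallel to an axis and ending at the corner \<open>1\<close>, the
  generating function depends on a single offspring count; domination by the probabilities
  themselves turns its sum over vectors into an expectation.\<close>

lemma offspring_gf_eq_expectation:
  assumes "0 \<le> x" "x \<le> 1"
  shows "offspring_gf P (\<chi> k. if k = j then x else 1) $ i
       = measure_pmf.expectation (P i) (\<lambda>y. x ^ (y $ j))"
proof -
  have "Infinite_Set_Sum.abs_summable_on (\<lambda>y. pmf (P i) y * x ^ (y $ j)) UNIV"
    by (rule abs_summable_on_comparison_test'[OF pmf_abs_summable[of "P i"]])
      (use assms in \<open>auto simp: abs_mult power_le_one intro!: mult_left_le\<close>)
  then have "measure_pmf.expectation (P i) (\<lambda>y. x ^ (y $ j)) = (\<Sum>\<^sub>\<infinity>y. pmf (P i) y * x ^ (y $ j))"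
    by (simp add: pmf_expectation_eq_infsetsum infsetsum_infsum)
  moreover have "pmf (P i) y * (\<chi> k. if k = j then x else 1) $ 1 ^ (y $ 1)
      * (\<chi> k. if k = j then x else 1) $ 2 ^ (y $ 2) = pmf (P i) y * x ^ (y $ j)" for y
    using exhaust_2[of j] by auto
  ultimately show ?thesis
    unfolding offspring_gf_def by (simp only: vec_lambda_beta)
qed

text \<open>Fatou's lemma for the difference quotients \<open>\<Sum>l<y $ j. x ^ l\<close> of the generating function as \<open>x \<rightarrow> 1\<close>.\<close>

lemma offspring_mean_le:
  assumes "has_mean_matrix P M"
  shows "0 \<le> M $ i $ j" "(\<integral>\<^sup>+y. ennreal (real (y $ j)) \<partial>P i) \<le> ennreal (M $ i $ j)"
proof -
  define G where "G x = offspring_gf P (\<chi> k. if k = j then x else 1) $ i" for x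
  \<comment> \<open>Fatou's lemma is applied along a sequence; this one increases to 1 without
    reaching it, so it follows the one-sided derivative.\<close>
  define x :: "nat \<Rightarrow> real" where "x n = 1 - 1 / (real n + 2)" for n
  have x: "0 \<le> x n" "x n < 1" for n
    by (auto simp: x_def field_simps)
  have "x \<longlonglongrightarrow> 1"
    unfolding x_def by real_asymp
  then have "filterlim x (at 1 within {0..1}) sequentially"
    using x by (auto simp: filterlim_at less_imp_le less_imp_neq intro!: always_eventually)
  moreover have "((\<lambda>y. (G y - G 1) / (y - 1)) \<longlongrightarrow> M $ i $ j) (at 1 within {0..1})"
    using assms by (simp add: has_mean_matrix_def G_def has_field_derivative_iff)
  ultimately have lim: "(\<lambda>n. (G (x n) - G 1) / (x n - 1)) \<longlonglongrightarrow> M $ i $ j"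
    by (rule filterlim_compose[rotated])
  have quotient: "0 \<le> (G (x n) - G 1) / (x n - 1)"
    "(\<integral>\<^sup>+y. ennreal (\<Sum>l<y $ j. x n ^ l) \<partial>P i) = ennreal ((G (x n) - G 1) / (x n - 1))" for n
  proof -
    have pow: "integrable (P i) (\<lambda>y. x n ^ (y $ j))"
      using x[of n] by (intro measure_pmf.integrable_const_bound[of _ 1]) (auto simp: power_le_one)
    have geo: "(\<Sum>l<y $ j. x n ^ l) = (x n ^ (y $ j) - 1) / (x n - 1)" for y :: "nat ^ 2"
      using x[of n] by (simp add: geometric_sum)
    have "measure_pmf.expectation (P i) (\<lambda>y. \<Sum>l<y $ j. x n ^ l) = (G (x n) - G 1) / (x n - 1)"
      unfolding geo G_def using x[of n] pow
      by (subst (1 2) offspring_gf_eq_expectation) auto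
    moreover have "integrable (P i) (\<lambda>y. \<Sum>l<y $ j. x n ^ l)"
      unfolding geo using pow by auto
    moreover have "0 \<le> measure_pmf.expectation (P i) (\<lambda>y. \<Sum>l<y $ j. x n ^ l)"
      using x[of n] by (intro integral_nonneg_AE) (auto intro!: sum_nonneg)
    ultimately show "0 \<le> (G (x n) - G 1) / (x n - 1)"
      and "(\<integral>\<^sup>+y. ennreal (\<Sum>l<y $ j. x n ^ l) \<partial>P i) = ennreal ((G (x n) - G 1) / (x n - 1))"
      using x[of n] by (simp_all add: nn_integral_eq_integral sum_nonneg)
  qed
  have "(\<lambda>n. ennreal (\<Sum>l<y $ j. x n ^ l)) \<longlonglongrightarrow> ennreal (\<Sum>l<y $ j. 1 ^ l)" for y :: "nat ^ 2"
    by (intro tendsto_ennrealI tendsto_sum tendsto_power \<open>x \<longlonglongrightarrow> 1\<close>)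
  then have "liminf (\<lambda>n. ennreal (\<Sum>l<y $ j. x n ^ l)) = ennreal (real (y $ j))" for y :: "nat ^ 2"
    by (subst lim_imp_Liminf[of sequentially _ "ennreal (real (y $ j))"]) auto
  then have "(\<integral>\<^sup>+y. ennreal (real (y $ j)) \<partial>P i)
      \<le> liminf (\<lambda>n. \<integral>\<^sup>+y. ennreal (\<Sum>l<y $ j. x n ^ l) \<partial>P i)"
    using nn_integral_liminf[of "\<lambda>n y. ennreal (\<Sum>l<y $ j. x n ^ l)" "P i"] by simp
  also have "\<dots> = ennreal (M $ i $ j)"
    unfolding quotient(2) by (intro lim_imp_Liminf tendsto_ennrealI lim) simp
  finally show "(\<integral>\<^sup>+y. ennreal (real (y $ j)) \<partial>P i) \<le> ennreal (M $ i $ j)" .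
  \<comment> \<open>The integral bound alone does not give this, since \<open>ennreal\<close> sends
    negative numbers to 0.\<close>
  show "0 \<le> M $ i $ j"
    by (rule LIMSEQ_le_const[OF lim]) (use quotient(1) in blast)
qed

subsection \<open>Moment generating functions of random sums\<close>

text \<open>Countability of the value type is the reason: once the value of one summand is fixed,
  adding it is a translation, and countably many such cases are glued together.\<close>

lemma measurable_count_space_sum:
  fixes f :: "'b \<Rightarrow> 'a \<Rightarrow> 'c :: {countable, comm_monoid_add}"
  assumes "\<And>p. p \<in> F \<Longrightarrow> f p \<in> M \<rightarrow>\<^sub>M count_space UNIV"
  shows "(\<lambda>\<omega>. \<Sum>p\<in>F. f p \<omega>) \<in> M \<rightarrow>\<^sub>M count_space UNIV"
  using assms
proof (induction F rule: infinite_finite_induct)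
  case (insert p F)
  have sum: "(\<lambda>\<omega>. \<Sum>p\<in>F. f p \<omega>) \<in> M \<rightarrow>\<^sub>M count_space UNIV"
    using insert by simp
  have "(\<lambda>\<omega>. x + (\<Sum>p\<in>F. f p \<omega>)) \<in> M \<rightarrow>\<^sub>M count_space UNIV" for x
    by (rule measurable_compose[OF sum]) simp
  moreover have "f p \<in> M \<rightarrow>\<^sub>M count_space UNIV"
    using insert by simp
  ultimately have "(\<lambda>\<omega>. f p \<omega> + (\<Sum>p\<in>F. f p \<omega>)) \<in> M \<rightarrow>\<^sub>M count_space UNIV"
    by (rule measurable_compose_countable)
  then show ?case
    using insert by simp
qed simp_all

lemma measurable_random_sum:
  fixes V :: "'a \<Rightarrow> nat ^ 2" and f :: "2 \<Rightarrow> nat \<Rightarrow> 'a \<Rightarrow> nat ^ 2"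
  assumes "V \<in> M \<rightarrow>\<^sub>M count_space UNIV" "\<And>i m. f i m \<in> M \<rightarrow>\<^sub>M count_space UNIV"
  shows "(\<lambda>\<omega>. \<Sum>i\<in>UNIV. \<Sum>m<V \<omega> $ i. f i m \<omega>) \<in> M \<rightarrow>\<^sub>M count_space UNIV"
  by (rule measurable_compose_countable[of "\<lambda>x \<omega>. \<Sum>i\<in>UNIV. \<Sum>m<x $ i. f i m \<omega>"])
    (intro measurable_count_space_sum assms)+

text \<open>The restriction to \<open>r < n\<close> allows an application on product spaces that
  contain only the coordinates of the earlier generations.\<close>

lemma measurable_progeny:
  assumes "a \<in> M \<rightarrow>\<^sub>M count_space UNIV" "\<And>r i m. r < n \<Longrightarrow> \<zeta> r i m \<in> M \<rightarrow>\<^sub>M count_space UNIV"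
  shows "progeny \<zeta> a n \<in> M \<rightarrow>\<^sub>M count_space UNIV"
  using assms
proof (induction n)
  case 0
  then show ?case
    by (simp cong: measurable_cong)
next
  case (Suc n)
  then have "progeny \<zeta> a n \<in> M \<rightarrow>\<^sub>M count_space UNIV"
    by simp
  then show ?case
    unfolding progeny.simps using Suc.prems by (intro measurable_random_sum) auto
qed

text \<open>
  \<open>V\<close> is the population of one generation, a function of the variables indexed by \<open>A\<close> (the past), and
  \<open>W (\<tau> i m)\<close> is the offspring of its \<open>m\<close>-th particle of type \<open>i\<close>; the proof conditions on \<open>V\<close>.
\<close>

lemma (in prob_space) nn_integral_exp_random_sum_le:
  fixes W :: "'j \<Rightarrow> 'a \<Rightarrow> nat ^ 2" and \<tau> :: "2 \<Rightarrow> nat \<Rightarrow> 'j"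
  assumes indep: "indep_vars (\<lambda>_. count_space UNIV) W J"
    and A: "A \<subseteq> J" and \<tau>: "\<And>i m. \<tau> i m \<in> J - A" "inj (\<lambda>(i, m). \<tau> i m)"
    and G: "G \<in> PiM A (\<lambda>_. count_space UNIV) \<rightarrow>\<^sub>M count_space UNIV"
    and V: "\<And>\<omega>. V \<omega> = G (restrict (\<lambda>j. W j \<omega>) A)"
    and law: "\<And>i m. distr M (count_space UNIV) (W (\<tau> i m)) = measure_pmf (P i)"
    and mgf: "\<And>i. (\<integral>\<^sup>+y. ennreal (exp (t * (u \<bullet> real_vec y))) \<partial>P i) \<le> ennreal (exp (t' * u $ i))"
  shows "(\<integral>\<^sup>+\<omega>. ennreal (exp (t * (u \<bullet> real_vec (\<Sum>i\<in>UNIV. \<Sum>m<V \<omega> $ i. W (\<tau> i m) \<omega>)))) \<partial>M)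
       \<le> (\<integral>\<^sup>+\<omega>. ennreal (exp (t' * (u \<bullet> real_vec (V \<omega>)))) \<partial>M)"
proof -
  define e where "e s y = ennreal (exp (s * (u \<bullet> real_vec y)))" for s and y :: "nat ^ 2"
  define S where "S \<omega> = (\<Sum>i\<in>UNIV. \<Sum>m<V \<omega> $ i. W (\<tau> i m) \<omega>)" for \<omega>
  have W [measurable]: "W j \<in> M \<rightarrow>\<^sub>M count_space UNIV" if "j \<in> J" for j
    using indep that by (auto simp: indep_vars_def)
  have V_meas [measurable]: "V \<in> M \<rightarrow>\<^sub>M count_space UNIV"
    unfolding V[abs_def] using A W by (intro measurable_compose[OF _ G] measurable_restrict) auto
  have W\<tau> [measurable]: "W (\<tau> i m) \<in> M \<rightarrow>\<^sub>M count_space UNIV" for i m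
    using \<tau>(1)[of i m] by (intro W) auto
  have \<tau>_eq: "\<tau> i m = \<tau> i' m' \<longleftrightarrow> i = i' \<and> m = m'" for i m i' m'
    using injD[OF \<tau>(2), of "(i, m)" "(i', m')"] by auto
  define T where "T x = (SIGMA i:UNIV. {..<x $ i})" for x :: "nat ^ 2"
  have fin_T: "finite (T x)" for x
    by (auto simp: T_def)
  have S_eq: "S \<omega> = (\<Sum>p\<in>T (V \<omega>). W (case p of (i, m) \<Rightarrow> \<tau> i m) \<omega>)" for \<omega>
    unfolding S_def T_def by (subst sum.Sigma) (auto simp: split_def)
  have S_meas [measurable]: "S \<in> M \<rightarrow>\<^sub>M count_space UNIV"
    unfolding S_def by (intro measurable_random_sum V_meas W\<tau>)
  have e_meas [measurable]: "e s \<in> borel_measurable (count_space UNIV)" for s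
    by simp
  \<comment> \<open>On the event \<open>V = x\<close> the number of summands is no longer random,
    and the exponential of the sum is a finite product.\<close>
  have slice: "(\<integral>\<^sup>+\<omega>. e t (S \<omega>) * indicator (V -` {x}) \<omega> \<partial>M)
      \<le> (\<integral>\<^sup>+\<omega>. e t' (V \<omega>) * indicator (V -` {x}) \<omega> \<partial>M)" for x
  proof -
    \<comment> \<open>Blocks of independent variables: \<open>None\<close> stands for the whole
      past, which determines the event \<open>V = x\<close>, and \<open>Some (i, m)\<close> for the
      offspring of one particle. \<open>F\<close> gives the factor contributed by each
      block.\<close>
    define K where "K l = (case l of None \<Rightarrow> A | Some (i, m) \<Rightarrow> {\<tau> i m})" for l :: "(2 \<times> nat) option"
    define F where "F l f = (case l of None \<Rightarrow> indicator {x} (G f) | Some (i, m) \<Rightarrow> e t (f (\<tau> i m)))" for l f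
    define L where "L = insert None (Some ` T x)"
    have "disjoint_family_on K L"
      unfolding disjoint_family_on_def K_def
      using \<tau>(1) \<tau>_eq by (auto split: option.split)
    then have "indep_vars (\<lambda>l. PiM (K l) (\<lambda>_. count_space UNIV)) (\<lambda>l \<omega>. restrict (\<lambda>j. W j \<omega>) (K l)) L"
      using \<tau>(1) A by (intro indep_vars_restrict[OF indep]) (auto simp: K_def[of "None"] K_def[of "Some _"] L_def)
    moreover have "F l \<in> borel_measurable (PiM (K l) (\<lambda>_. count_space UNIV))" for l
    proof (cases l)
      case None
      then show ?thesis
        unfolding F_def K_def by (auto intro!: measurable_compose[OF G])
    next
      case (Some p)
      obtain i m where "p = (i, m)" by fastforce
      then show ?thesis
        unfolding F_def K_def Some
        by (auto intro!: measurable_compose[OF measurable_component_singleton])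
    qed
    ultimately have "indep_vars (\<lambda>_. borel) (\<lambda>l \<omega>. F l (restrict (\<lambda>j. W j \<omega>) (K l))) L"
      by (rule indep_vars_compose2)
    then have prod: "(\<integral>\<^sup>+\<omega>. (\<Prod>l\<in>L. F l (restrict (\<lambda>j. W j \<omega>) (K l))) \<partial>M)
        = (\<Prod>l\<in>L. \<integral>\<^sup>+\<omega>. F l (restrict (\<lambda>j. W j \<omega>) (K l)) \<partial>M)"
      by (intro indep_vars_nn_integral) (auto simp: L_def fin_T)
    have L_prod: "(\<Prod>l\<in>L. h l) = h None * (\<Prod>p\<in>T x. h (Some p))" for h :: "_ \<Rightarrow> ennreal"
      unfolding L_def using fin_T by (subst prod.insert) (auto simp: prod.reindex)
    have F_None: "F None (restrict (\<lambda>j. W j \<omega>) (K None)) = indicator (V -` {x}) \<omega>" for \<omega>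
      by (auto simp: F_def K_def V indicator_def)
    have F_Some: "F (Some p) (restrict (\<lambda>j. W j \<omega>) (K (Some p))) = e t (W (case p of (i, m) \<Rightarrow> \<tau> i m) \<omega>)" for p \<omega>
      by (auto simp: F_def K_def split: prod.split)
    have e_sum: "e s (\<Sum>p\<in>T x. f p) = (\<Prod>p\<in>T x. e s (f p))" for s and f :: "_ \<Rightarrow> nat ^ 2"
      by (simp add: e_def real_vec_sum inner_sum_right sum_distrib_left exp_sum fin_T prod_ennreal)
    have "(\<integral>\<^sup>+\<omega>. e t (S \<omega>) * indicator (V -` {x}) \<omega> \<partial>M)
        = (\<integral>\<^sup>+\<omega>. (\<Prod>l\<in>L. F l (restrict (\<lambda>j. W j \<omega>) (K l))) \<partial>M)"
      unfolding L_prod F_None F_Some e_sum[symmetric]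
      by (intro nn_integral_cong) (auto simp: S_eq indicator_def)
    also have "\<dots> = (\<integral>\<^sup>+\<omega>. indicator (V -` {x}) \<omega> \<partial>M)
        * (\<Prod>p\<in>T x. \<integral>\<^sup>+\<omega>. e t (W (case p of (i, m) \<Rightarrow> \<tau> i m) \<omega>) \<partial>M)"
      unfolding prod by (simp only: L_prod F_None F_Some)
    also have "\<dots> \<le> (\<integral>\<^sup>+\<omega>. indicator (V -` {x}) \<omega> \<partial>M) * (\<Prod>p\<in>T x. ennreal (exp (t' * u $ fst p)))"
    proof (intro mult_left_mono prod_mono_ennreal)
      fix p
      have "(\<integral>\<^sup>+\<omega>. e t (W (\<tau> i m) \<omega>) \<partial>M) = (\<integral>\<^sup>+y. e t y \<partial>P i)" for i m
        unfolding law[of i m, symmetric] by (subst nn_integral_distr) auto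
      then show "(\<integral>\<^sup>+\<omega>. e t (W (case p of (i, m) \<Rightarrow> \<tau> i m) \<omega>) \<partial>M) \<le> ennreal (exp (t' * u $ fst p))"
        using mgf[of "fst p"] by (simp add: split_def e_def)
    qed simp
    also have "(\<Prod>p\<in>T x. ennreal (exp (t' * u $ fst p))) = e t' x"
    proof -
      have "(\<Sum>p\<in>T x. t' * u $ fst p) = (\<Sum>i\<in>UNIV. \<Sum>m<x $ i. t' * u $ i)"
        unfolding T_def by (subst sum.Sigma) (auto simp: split_def)
      also have "\<dots> = t' * (u \<bullet> real_vec x)"
        by (simp add: inner_real_vec sum_distrib_left mult_ac)
      finally show ?thesis
        by (simp add: e_def prod_ennreal exp_sum[symmetric] fin_T)
    qed
    also have "(\<integral>\<^sup>+\<omega>. indicator (V -` {x}) \<omega> \<partial>M) * e t' x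
        = (\<integral>\<^sup>+\<omega>. e t' (V \<omega>) * indicator (V -` {x}) \<omega> \<partial>M)"
    proof -
      have indicator_eq: "(indicator (V -` {x}) :: 'a \<Rightarrow> ennreal) = (\<lambda>\<omega>. indicator {x} (V \<omega>))"
        by (auto simp: indicator_def)
      have "(indicator (V -` {x}) :: 'a \<Rightarrow> ennreal) \<in> borel_measurable M"
        unfolding indicator_eq by (intro measurable_compose[OF V_meas]) auto
      then show ?thesis
        by (subst nn_integral_multc[symmetric]) (auto intro!: nn_integral_cong simp: indicator_def)
    qed
    finally show ?thesis .
  qed
  \<comment> \<open>Numbering the possible values of \<open>V\<close> by \<open>to_nat\<close>
    yields a countable measurable partition on whose pieces \<open>V\<close> is constant, so that
    the slices can be summed.\<close>
  define B where "B n = (\<lambda>\<omega>. to_nat (V \<omega>)) -` {n} \<inter> space M" for n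
  have B: "B n \<in> sets M" for n
    unfolding B_def by (rule measurable_sets[of _ M "count_space UNIV"]) auto
  have disj: "disjoint_family B"
    by (auto simp: disjoint_family_on_def B_def)
  have split: "(\<integral>\<^sup>+\<omega>. h \<omega> \<partial>M) = (\<Sum>n. \<integral>\<^sup>+\<omega>\<in>B n. h \<omega> \<partial>M)" if "h \<in> borel_measurable M" for h
    unfolding nn_integral_disjoint_family[OF that B disj, symmetric]
    by (intro nn_integral_cong) (auto simp: B_def)
  have "(\<integral>\<^sup>+\<omega>\<in>B n. e t (S \<omega>) \<partial>M) \<le> (\<integral>\<^sup>+\<omega>\<in>B n. e t' (V \<omega>) \<partial>M)" for n
  proof (cases "B n = {}")
    case False
    then obtain \<omega>\<^sub>0 where "to_nat (V \<omega>\<^sub>0) = n"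
      by (auto simp: B_def)
    then have "\<omega> \<in> B n \<longleftrightarrow> \<omega> \<in> V -` {V \<omega>\<^sub>0}" if "\<omega> \<in> space M" for \<omega>
      using that by (auto simp: B_def)
    then have "(\<integral>\<^sup>+\<omega>\<in>B n. h \<omega> \<partial>M) = (\<integral>\<^sup>+\<omega>. h \<omega> * indicator (V -` {V \<omega>\<^sub>0}) \<omega> \<partial>M)" for h
      by (intro nn_integral_cong) (auto simp: indicator_def)
    then show ?thesis
      using slice by simp
  qed simp
  then have "(\<Sum>n. \<integral>\<^sup>+\<omega>\<in>B n. e t (S \<omega>) \<partial>M) \<le> (\<Sum>n. \<integral>\<^sup>+\<omega>\<in>B n. e t' (V \<omega>) \<partial>M)"
    by (intro suminf_le) auto
  then have "(\<integral>\<^sup>+\<omega>. e t (S \<omega>) \<partial>M) \<le> (\<integral>\<^sup>+\<omega>. e t' (V \<omega>) \<partial>M)"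
    by (subst (1 2) split) auto
  then show ?thesis
    by (simp add: e_def S_def)
qed

section \<open>Iteration over the generations of one family\<close>

text \<open>The same recursion is run on a product space, with coordinates in the role of the
  offspring vectors. This exhibits a population as a function of the variables indexed by
  \<open>A\<close>, the form in which independence of blocks is used.\<close>

lemma progeny_restrict:
  assumes "\<alpha> (restrict w A) = a \<omega>" "\<And>r i m. r < n \<Longrightarrow> \<tau> r i m \<in> A \<and> w (\<tau> r i m) = \<zeta> r i m \<omega>"
  shows "progeny (\<lambda>r i m f. f (\<tau> r i m)) \<alpha> n (restrict w A) = progeny \<zeta> a n \<omega>"
  using assms by (induction n) auto

text \<open>The last generation is integrated out first, which trades \<open>\<psi> s\<close> for
  \<open>\<psi> (\<rho> * s)\<close>; hence the induction on \<open>n\<close> with \<open>s\<close>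
  arbitrary. The map \<open>\<alpha>\<close> reads the initial vector off the coordinates in
  \<open>A\<close>, and it is required on every larger \<open>B\<close> because the past of
  generation \<open>n\<close> grows with \<open>n\<close>.\<close>

lemma (in prob_space) nn_integral_exp_progeny_le:
  fixes W :: "'j \<Rightarrow> 'a \<Rightarrow> nat ^ 2" and \<tau> :: "nat \<Rightarrow> 2 \<Rightarrow> nat \<Rightarrow> 'j" and \<rho> \<theta> :: real
  assumes indep: "indep_vars (\<lambda>_. count_space UNIV) W J"
    and A: "A \<subseteq> J" and \<tau>: "\<And>r i m. \<tau> r i m \<in> J - A" "inj (\<lambda>(r, i, m). \<tau> r i m)"
    and \<alpha>: "\<And>B. A \<subseteq> B \<Longrightarrow> \<alpha> \<in> PiM B (\<lambda>_. count_space UNIV) \<rightarrow>\<^sub>M count_space UNIV"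
      "\<And>B \<omega>. A \<subseteq> B \<Longrightarrow> \<alpha> (restrict (\<lambda>j. W j \<omega>) B) = a \<omega>"
    and law: "\<And>r i m. distr M (count_space UNIV) (W (\<tau> r i m)) = measure_pmf (P i)"
    and \<rho>: "1 \<le> \<rho>"
    and mgf: "\<And>s i. 0 \<le> s \<Longrightarrow> \<rho> * s \<le> \<theta> \<Longrightarrow>
      (\<integral>\<^sup>+y. ennreal (exp (\<psi> s * (u \<bullet> real_vec y))) \<partial>P i) \<le> ennreal (exp (\<psi> (\<rho> * s) * u $ i))"
    and s: "0 \<le> s" "\<rho> ^ n * s \<le> \<theta>"
  shows "(\<integral>\<^sup>+\<omega>. ennreal (exp (\<psi> s * (u \<bullet> real_vec (progeny (\<lambda>r i m. W (\<tau> r i m)) a n \<omega>)))) \<partial>M)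
       \<le> (\<integral>\<^sup>+\<omega>. ennreal (exp (\<psi> (\<rho> ^ n * s) * (u \<bullet> real_vec (a \<omega>)))) \<partial>M)"
  using s
proof (induction n arbitrary: s)
  case (Suc n)
  \<comment> \<open>The past of generation \<open>n\<close>: the coordinates of the initial vector
    and the offspring variables of all earlier generations.\<close>
  let ?B = "A \<union> {\<tau> r i m | r i m. r < n}"
  have \<tau>_eq: "\<tau> r i m = \<tau> r' i' m' \<longleftrightarrow> r = r' \<and> i = i' \<and> m = m'" for r i m r' i' m'
    using injD[OF \<tau>(2), of "(r, i, m)" "(r', i', m')"] by auto
  have IH: "\<rho> ^ n * (\<rho> * s) \<le> \<theta>" "0 \<le> \<rho> * s"
    using Suc.prems \<rho> by (auto simp: mult_ac)
  have "1 * (\<rho> * s) \<le> \<rho> ^ n * (\<rho> * s)"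
    using \<rho> IH(2) by (intro mult_right_mono) auto
  with IH(1) have step: "\<rho> * s \<le> \<theta>"
    by linarith
  have "(\<integral>\<^sup>+\<omega>. ennreal (exp (\<psi> s * (u \<bullet> real_vec (progeny (\<lambda>r i m. W (\<tau> r i m)) a (Suc n) \<omega>)))) \<partial>M)
      \<le> (\<integral>\<^sup>+\<omega>. ennreal (exp (\<psi> (\<rho> * s) * (u \<bullet> real_vec (progeny (\<lambda>r i m. W (\<tau> r i m)) a n \<omega>)))) \<partial>M)"
    unfolding progeny.simps
  proof (rule nn_integral_exp_random_sum_le[OF indep])
    show "?B \<subseteq> J"
      using A \<tau>(1) by auto
    show "\<tau> n i m \<in> J - ?B" for i m
      using \<tau>(1)[of n i m] by (auto simp: \<tau>_eq)
    show "inj (\<lambda>(i, m). \<tau> n i m)"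
      by (auto simp: inj_on_def \<tau>_eq)
    show "progeny (\<lambda>r i m f. f (\<tau> r i m)) \<alpha> n \<in> PiM ?B (\<lambda>_. count_space UNIV) \<rightarrow>\<^sub>M count_space UNIV"
      by (intro measurable_progeny \<alpha>(1) measurable_component_singleton) auto
    show "progeny (\<lambda>r i m. W (\<tau> r i m)) a n \<omega>
        = progeny (\<lambda>r i m f. f (\<tau> r i m)) \<alpha> n (restrict (\<lambda>j. W j \<omega>) ?B)" for \<omega>
      by (rule progeny_restrict[symmetric]) (auto intro: \<alpha>(2))
  qed (use law mgf[OF \<open>0 \<le> s\<close> step] in auto)
  also have "\<dots> \<le> (\<integral>\<^sup>+\<omega>. ennreal (exp (\<psi> (\<rho> ^ n * (\<rho> * s)) * (u \<bullet> real_vec (a \<omega>)))) \<partial>M)"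
    using IH by (intro Suc.IH)
  finally show ?case
    by (simp add: mult_ac)
qed simp

section \<open>Choice of the exponents and one-step moment bounds\<close>

text \<open>
  For \<open>C = 0\<close> the logarithmic moment generating functions would be linear and \<open>s \<mapsto> s\<close> would serve as \<open>\<psi>\<close>;
  the quadratic correction absorbs \<open>C\<close> because \<open>s\<^sup>2\<close> grows by \<open>\<rho>\<^sup>2 > \<rho>\<close> per generation.
\<close>

lemma exp_supersolution:
  fixes C c \<rho> :: real
  assumes "0 \<le> C" "0 < c" "1 < \<rho>"
  obtains B \<theta> where "0 \<le> B" "0 < \<theta>" "B * \<theta> \<le> 1" "2 * \<theta> \<le> c"
    "\<And>s. 0 \<le> s \<Longrightarrow> s \<le> \<theta> \<Longrightarrow> \<rho> * (s + B * s\<^sup>2 + C * (s + B * s\<^sup>2)\<^sup>2) \<le> \<rho> * s + B * (\<rho> * s)\<^sup>2"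
proof -
  \<comment> \<open>Once \<open>s + B * s\<^sup>2\<close> is at most \<open>2 * s\<close>, the error
    is at most \<open>4 * C * s\<^sup>2\<close>; this \<open>B\<close> makes it equal to the gain
    \<open>B * (\<rho> - 1) * s\<^sup>2\<close>.\<close>
  define B where "B = 4 * C / (\<rho> - 1)"
  \<comment> \<open>The first bound keeps \<open>2 * s\<close> within the range \<open>c\<close> of
    the moment estimate, the second gives \<open>B * s\<^sup>2 \<le> s\<close>; adding 1 covers
    \<open>B = 0\<close>.\<close>
  define \<theta> where "\<theta> = min (c / 2) (1 / (B + 1))"
  have B: "0 \<le> B" "B * (\<rho> - 1) = 4 * C"
    using assms by (auto simp: B_def)
  have \<theta>: "0 < \<theta>" "2 * \<theta> \<le> c"
    using assms B by (auto simp: \<theta>_def)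
  have "B * \<theta> \<le> B * (1 / (B + 1))"
    using B by (intro mult_left_mono) (auto simp: \<theta>_def)
  also have "\<dots> \<le> 1"
    using B by (simp add: field_simps)
  finally have B\<theta>: "B * \<theta> \<le> 1" .
  show thesis
  proof (rule that[OF B(1) \<theta>(1) B\<theta> \<theta>(2)])
    fix s :: real
    assume s: "0 \<le> s" "s \<le> \<theta>"
    have "B * s \<le> 1"
      using B\<theta> mult_left_mono[OF s(2) B(1)] by simp
    then have "B * s * s \<le> 1 * s"
      using s by (intro mult_right_mono)
    then have "(s + B * s\<^sup>2)\<^sup>2 \<le> (2 * s)\<^sup>2"
      using s B by (intro power_mono) (auto simp: power2_eq_square)
    then have "C * (s + B * s\<^sup>2)\<^sup>2 \<le> C * (4 * s\<^sup>2)"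
      using assms by (intro mult_left_mono) (auto simp: power2_eq_square)
    also have "\<dots> = B * (\<rho> - 1) * s\<^sup>2"
      using B by simp
    finally have "s + B * s\<^sup>2 + C * (s + B * s\<^sup>2)\<^sup>2 \<le> s + B * \<rho> * s\<^sup>2"
      by (simp add: algebra_simps)
    then have "\<rho> * (s + B * s\<^sup>2 + C * (s + B * s\<^sup>2)\<^sup>2) \<le> \<rho> * (s + B * \<rho> * s\<^sup>2)"
      using assms by (intro mult_left_mono) auto
    then show "\<rho> * (s + B * s\<^sup>2 + C * (s + B * s\<^sup>2)\<^sup>2) \<le> \<rho> * s + B * (\<rho> * s)\<^sup>2"
      by (simp add: algebra_simps power2_eq_square)
  qed
qed

text \<open>Integrating the convexity bound gives \<open>1 + K * t \<le> exp (K * t)\<close>, where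
  \<open>K\<close> is the moment at \<open>c\<close> divided by \<open>c\<close>. This first-order
  estimate suffices for the immigration, whose vectors enter once per family with geometrically
  decreasing exponents.\<close>

lemma (in prob_space) exp_moment_le_exp_linear:
  fixes Y :: "'a \<Rightarrow> real"
  assumes [measurable]: "Y \<in> borel_measurable M"
    and "0 < c" "(\<integral>\<^sup>+\<omega>. ennreal (exp (c * Y \<omega>)) \<partial>M) < \<infinity>"
  obtains K where "0 \<le> K" "\<And>t. 0 \<le> t \<Longrightarrow> t \<le> c \<Longrightarrow> (\<integral>\<^sup>+\<omega>. ennreal (exp (t * Y \<omega>)) \<partial>M) \<le> ennreal (exp (K * t))"
proof -
  define D where "D = enn2real (\<integral>\<^sup>+\<omega>. ennreal (exp (c * Y \<omega>)) \<partial>M)"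
  have D: "(\<integral>\<^sup>+\<omega>. ennreal (exp (c * Y \<omega>)) \<partial>M) = ennreal D" "0 \<le> D"
    using assms(3) by (auto simp: D_def)
  have "(\<integral>\<^sup>+\<omega>. ennreal (exp (t * Y \<omega>)) \<partial>M) \<le> ennreal (exp (D / c * t))" if "0 \<le> t" "t \<le> c" for t
  proof -
    have "(\<integral>\<^sup>+\<omega>. ennreal (exp (t * Y \<omega>)) \<partial>M) \<le> (\<integral>\<^sup>+\<omega>. 1 + ennreal (t / c) * ennreal (exp (c * Y \<omega>)) \<partial>M)"
      using that assms(2) exp_mult_le_linear[OF that assms(2)]
      by (intro nn_integral_mono)
        (simp flip: ennreal_mult ennreal_plus ennreal_1 add: ennreal_leI)
    also have "\<dots> = 1 + ennreal (t / c) * ennreal D"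
      by (simp add: nn_integral_add nn_integral_cmult D emeasure_space_1)
    also have "\<dots> = ennreal (1 + D / c * t)"
      using that assms(2) D(2) by (simp flip: ennreal_mult ennreal_plus ennreal_1 add: mult_ac)
    also have "\<dots> \<le> ennreal (exp (D / c * t))"
      by (intro ennreal_leI exp_ge_add_one_self)
    finally show ?thesis .
  qed
  with D(2) assms(2) show thesis
    by (intro that[of "D / c"]) auto
qed

text \<open>The linear term of the quadratic expansion has mean at most
  \<open>\<rho> * t * u $ i\<close> by the eigenvector equation. The remainder is also made
  proportional to \<open>u $ i\<close>: then the product over all particles is again the exponential
  of a multiple of the \<open>u\<close>-weighted population.\<close>

lemma offspring_mgf_le:
  fixes u :: "real ^ 2"
  assumes "has_mean_matrix P M" "M *v u = \<rho> *s u" "\<And>i. 0 < u $ i" "0 < \<rho>" "0 < c"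
    and fin: "\<And>i. (\<integral>\<^sup>+y. ennreal (exp (c * (u \<bullet> real_vec y))) \<partial>P i) < \<infinity>"
  obtains C where "0 \<le> C" "\<And>t i. 0 \<le> t \<Longrightarrow> t \<le> c \<Longrightarrow>
    (\<integral>\<^sup>+y. ennreal (exp (t * (u \<bullet> real_vec y))) \<partial>P i) \<le> ennreal (exp (\<rho> * (t + C * t\<^sup>2) * u $ i))"
proof -
  define D where "D i = enn2real (\<integral>\<^sup>+y. ennreal (exp (c * (u \<bullet> real_vec y))) \<partial>P i)" for i
  have D: "(\<integral>\<^sup>+y. ennreal (exp (c * (u \<bullet> real_vec y))) \<partial>P i) = ennreal (D i)" "0 \<le> D i" for i
    using fin[of i] by (auto simp: D_def)
  \<comment> \<open>Each summand is the constant required by one type; all are nonnegative, so their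
    sum serves both types.\<close>
  define C where "C = (\<Sum>i\<in>UNIV. D i / (c\<^sup>2 * \<rho> * u $ i))"
  have C: "D i / c\<^sup>2 \<le> \<rho> * C * u $ i" for i
  proof -
    have "D i / (c\<^sup>2 * \<rho> * u $ i) \<le> C"
      unfolding C_def using assms D(2) by (intro member_le_sum) (auto simp: less_imp_le)
    then have "D i / (c\<^sup>2 * \<rho> * u $ i) * (\<rho> * u $ i) \<le> C * (\<rho> * u $ i)"
      using assms by (intro mult_right_mono) (auto simp: less_imp_le)
    then show ?thesis
      using assms(3)[of i] assms(4) by (simp add: mult_ac)
  qed
  have mean: "(\<integral>\<^sup>+y. ennreal (u \<bullet> real_vec y) \<partial>P i) \<le> ennreal (\<rho> * u $ i)" for i
  proof -
    have "(\<integral>\<^sup>+y. ennreal (u \<bullet> real_vec y) \<partial>P i)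
        = (\<integral>\<^sup>+y. (\<Sum>j\<in>UNIV. ennreal (u $ j) * ennreal (real (y $ j))) \<partial>P i)"
      using assms(3) by (intro nn_integral_cong) (simp add: inner_real_vec less_imp_le flip: ennreal_mult sum_ennreal)
    also have "\<dots> = (\<Sum>j\<in>UNIV. ennreal (u $ j) * (\<integral>\<^sup>+y. ennreal (real (y $ j)) \<partial>P i))"
      by (simp add: nn_integral_sum nn_integral_cmult)
    also have "\<dots> \<le> (\<Sum>j\<in>UNIV. ennreal (u $ j) * ennreal (M $ i $ j))"
      using offspring_mean_le(2)[OF assms(1)] by (intro sum_mono mult_left_mono) auto
    also have "\<dots> = ennreal (\<Sum>j\<in>UNIV. M $ i $ j * u $ j)"
      using offspring_mean_le(1)[OF assms(1)] assms(3)
      by (simp add: less_imp_le mult.commute flip: ennreal_mult sum_ennreal)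
    also have "(\<Sum>j\<in>UNIV. M $ i $ j * u $ j) = \<rho> * u $ i"
      using arg_cong[OF assms(2), of "\<lambda>x. x $ i"] by (simp add: matrix_vector_mult_def)
    finally show ?thesis .
  qed
  have "(\<integral>\<^sup>+y. ennreal (exp (t * (u \<bullet> real_vec y))) \<partial>P i) \<le> ennreal (exp (\<rho> * (t + C * t\<^sup>2) * u $ i))"
    if t: "0 \<le> t" "t \<le> c" for t i
  proof -
    have nonneg: "0 \<le> u \<bullet> real_vec y" for y
      using assms(3) by (intro inner_real_vec_nonneg less_imp_le)
    have "(\<integral>\<^sup>+y. ennreal (exp (t * (u \<bullet> real_vec y))) \<partial>P i)
        \<le> (\<integral>\<^sup>+y. 1 + ennreal t * ennreal (u \<bullet> real_vec y)
              + ennreal ((t / c)\<^sup>2) * ennreal (exp (c * (u \<bullet> real_vec y))) \<partial>P i)"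
      using t exp_mult_le_quadratic[OF t \<open>0 < c\<close>] nonneg
      by (intro nn_integral_mono) (simp flip: ennreal_mult ennreal_plus ennreal_1 add: ennreal_leI)
    also have "\<dots> = 1 + ennreal t * (\<integral>\<^sup>+y. ennreal (u \<bullet> real_vec y) \<partial>P i) + ennreal ((t / c)\<^sup>2) * ennreal (D i)"
      by (simp add: nn_integral_add nn_integral_cmult D)
    also have "\<dots> \<le> 1 + ennreal t * ennreal (\<rho> * u $ i) + ennreal ((t / c)\<^sup>2) * ennreal (D i)"
      by (intro add_mono mult_left_mono mean) auto
    also have "\<dots> = ennreal (1 + (t * (\<rho> * u $ i) + (t / c)\<^sup>2 * D i))"
      using t assms(3)[of i] assms(4) D(2)[of i]
      by (simp flip: ennreal_mult ennreal_plus ennreal_1 add: add.assoc)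
    also have "\<dots> \<le> ennreal (exp (t * (\<rho> * u $ i) + (t / c)\<^sup>2 * D i))"
      by (intro ennreal_leI exp_ge_add_one_self)
    also have "t * (\<rho> * u $ i) + (t / c)\<^sup>2 * D i = t * (\<rho> * u $ i) + t\<^sup>2 * (D i / c\<^sup>2)"
      by (simp add: power_divide)
    also have "ennreal (exp \<dots>) \<le> ennreal (exp (t * (\<rho> * u $ i) + t\<^sup>2 * (\<rho> * C * u $ i)))"
      by (intro ennreal_leI iffD2[OF exp_le_cancel_iff] add_left_mono mult_left_mono C) simp
    also have "t * (\<rho> * u $ i) + t\<^sup>2 * (\<rho> * C * u $ i) = \<rho> * (t + C * t\<^sup>2) * u $ i"
      by (simp add: algebra_simps)
    finally show ?thesis .
  qed
  moreover have "0 \<le> C"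
    unfolding C_def using assms D(2) by (intro sum_nonneg) (auto simp: less_imp_le)
  ultimately show thesis
    by (rule that[rotated])
qed

section \<open>Factorisation of the process with immigration over its families\<close>

lemma (in branching_with_immigration) measurable_immigration:
  assumes "1 \<le> k"
  shows "I k \<in> \<Omega> \<rightarrow>\<^sub>M count_space UNIV"
  using independent assms by (auto simp: indep_vars_def dest!: bspec[of _ _ "Inr k"])

text \<open>The families \<open>0\<close> to \<open>n\<close> read disjoint sets of the independent
  variables, so the exponential moment is a product. Family \<open>k\<close> has evolved for
  \<open>n - k\<close> generations, and its factor is bounded by going back to its initial
  vector.\<close>

lemma (in branching_with_immigration) nn_integral_exp_immigration_X_le:
  fixes \<rho> \<theta> :: real
  assumes \<rho>: "1 \<le> \<rho>"
    and mgf: "\<And>s i. 0 \<le> s \<Longrightarrow> \<rho> * s \<le> \<theta> \<Longrightarrow>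
      (\<integral>\<^sup>+y. ennreal (exp (\<psi> s * (u \<bullet> real_vec y))) \<partial>P i) \<le> ennreal (exp (\<psi> (\<rho> * s) * u $ i))"
    and s: "0 \<le> s" "\<rho> ^ n * s \<le> \<theta>"
  shows "(\<integral>\<^sup>+\<omega>. ennreal (exp (\<psi> s * (u \<bullet> real_vec (immigration_X \<xi> I z n \<omega>)))) \<partial>\<Omega>)
       \<le> ennreal (exp (\<psi> (\<rho> ^ n * s) * (u \<bullet> real_vec z)))
          * (\<Prod>k = 1..n. \<integral>\<^sup>+\<omega>. ennreal (exp (\<psi> (\<rho> ^ (n - k) * s) * (u \<bullet> real_vec (I 1 \<omega>)))) \<partial>\<Omega>)"
proof -
  define W where "W = case_sum (\<lambda>(k, n, i, m). \<xi> k n i m) I"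
  define J :: "(nat \<times> nat \<times> 2 \<times> nat + nat) set" where "J = UNIV <+> {1..}"
  have indep: "indep_vars (\<lambda>_. count_space UNIV) W J"
    using independent by (simp add: W_def J_def)
  define \<tau> where "\<tau> k r i m = (Inl (k, k + r, i, m) :: nat \<times> nat \<times> 2 \<times> nat + nat)" for k r i m
  \<comment> \<open>The initial particles are treated as family \<open>0\<close>. Their vector
    \<open>z\<close> is deterministic, so \<open>A 0\<close> is empty, while family
    \<open>k \<ge> 1\<close> reads its initial vector from the coordinate
    \<open>Inr k\<close>.\<close>
  define a where "a k = (if k = 0 then \<lambda>_. z else I k)" for k
  define \<alpha> where "\<alpha> k f = (if k = 0 then z else f (Inr k))"
    for k and f :: "nat \<times> nat \<times> 2 \<times> nat + nat \<Rightarrow> nat ^ 2"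
  define A :: "nat \<Rightarrow> (nat \<times> nat \<times> 2 \<times> nat + nat) set" where "A k = (if k = 0 then {} else {Inr k})" for k
  define Z where "Z k = progeny (\<lambda>r i m. W (\<tau> k r i m)) (a k) (n - k)" for k
  define K where "K k = A k \<union> {\<tau> k r i m | r i m. True}" for k
  define e where "e x = ennreal (exp (\<psi> s * (u \<bullet> real_vec x)))" for x
  have \<tau>_J: "\<tau> k r i m \<in> J - A k" for k r i m
    by (auto simp: \<tau>_def J_def A_def)
  have A_J: "A k \<subseteq> J" for k
    by (auto simp: J_def A_def)
  have W_\<tau>: "W (\<tau> k r i m) = \<xi> k (k + r) i m" for k r i m
    by (simp add: W_def \<tau>_def)
  have \<alpha>_meas: "\<alpha> k \<in> PiM B (\<lambda>_. count_space UNIV) \<rightarrow>\<^sub>M count_space UNIV" if "A k \<subseteq> B" for k B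
    using that unfolding \<alpha>_def[abs_def] A_def by (cases "k = 0") (auto intro!: measurable_component_singleton)
  have \<alpha>_eq: "\<alpha> k (restrict (\<lambda>j. W j \<omega>) B) = a k \<omega>" if "A k \<subseteq> B" for k B \<omega>
    using that by (auto simp: \<alpha>_def a_def A_def W_def)
  have X_eq: "immigration_X \<xi> I z n \<omega> = (\<Sum>k\<in>{0..n}. Z k \<omega>)" for \<omega>
    by (simp add: sum.atLeast_Suc_atMost immigration_X_def branching_Z_def immigrant_U_def Z_def W_\<tau> a_def)
  have e_X: "e (\<Sum>k\<in>{0..n}. Z k \<omega>) = (\<Prod>k\<in>{0..n}. e (Z k \<omega>))" for \<omega>
    by (simp add: e_def real_vec_sum inner_sum_right sum_distrib_left exp_sum prod_ennreal)
  have Z_eq: "e (Z k \<omega>)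
      = e (progeny (\<lambda>r i m f. f (\<tau> k r i m)) (\<alpha> k) (n - k) (restrict (\<lambda>j. W j \<omega>) (K k)))" for k \<omega>
    unfolding Z_def by (subst progeny_restrict) (auto simp: K_def intro!: \<alpha>_eq)
  have "indep_vars (\<lambda>k. PiM (K k) (\<lambda>_. count_space UNIV)) (\<lambda>k \<omega>. restrict (\<lambda>j. W j \<omega>) (K k)) {0..n}"
    using \<tau>_J A_J
    by (intro indep_vars_restrict[OF indep])
      (auto simp: K_def disjoint_family_on_def A_def \<tau>_def)
  then have "indep_vars (\<lambda>_. borel) (\<lambda>k \<omega>. e (progeny (\<lambda>r i m f. f (\<tau> k r i m)) (\<alpha> k) (n - k)
      (restrict (\<lambda>j. W j \<omega>) (K k)))) {0..n}"
    by (rule indep_vars_compose2)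
      (auto simp: K_def intro!: measurable_compose[OF measurable_progeny] \<alpha>_meas measurable_component_singleton)
  then have "(\<integral>\<^sup>+\<omega>. e (immigration_X \<xi> I z n \<omega>) \<partial>\<Omega>) = (\<Prod>k\<in>{0..n}. \<integral>\<^sup>+\<omega>. e (Z k \<omega>) \<partial>\<Omega>)"
    unfolding X_eq e_X Z_eq by (intro indep_vars_nn_integral) auto
  also have "\<dots> \<le> (\<Prod>k\<in>{0..n}. \<integral>\<^sup>+\<omega>. ennreal (exp (\<psi> (\<rho> ^ (n - k) * s) * (u \<bullet> real_vec (a k \<omega>)))) \<partial>\<Omega>)"
  proof (rule prod_mono_ennreal)
    fix k
    have "\<rho> ^ (n - k) * s \<le> \<rho> ^ n * s"
      using \<rho> s by (intro mult_right_mono power_increasing) auto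
    with s have "\<rho> ^ (n - k) * s \<le> \<theta>"
      by simp
    moreover have "inj (\<lambda>(r, i, m). \<tau> k r i m)"
      by (auto simp: inj_on_def \<tau>_def)
    moreover have "distr \<Omega> (count_space UNIV) (W (\<tau> k r i m)) = measure_pmf (P i)" for r i m
      by (simp add: W_\<tau> offspring_law)
    ultimately show "(\<integral>\<^sup>+\<omega>. e (Z k \<omega>) \<partial>\<Omega>)
        \<le> (\<integral>\<^sup>+\<omega>. ennreal (exp (\<psi> (\<rho> ^ (n - k) * s) * (u \<bullet> real_vec (a k \<omega>)))) \<partial>\<Omega>)"
      unfolding e_def Z_def
      by (intro nn_integral_exp_progeny_le[where J = J and A = "A k" and P = P and \<theta> = \<theta>, OF indep A_J \<tau>_J _ \<alpha>_meas \<alpha>_eq])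
        (use \<rho> mgf s in auto)
  qed
  \<comment> \<open>The factor for \<open>k = 0\<close> is the integral of a constant over a
    probability space.\<close>
  also have "\<dots> = ennreal (exp (\<psi> (\<rho> ^ n * s) * (u \<bullet> real_vec z)))
      * (\<Prod>k = 1..n. \<integral>\<^sup>+\<omega>. ennreal (exp (\<psi> (\<rho> ^ (n - k) * s) * (u \<bullet> real_vec (I k \<omega>)))) \<partial>\<Omega>)"
    by (simp add: prod.atLeast_Suc_atMost a_def emeasure_space_1)
  also have "(\<Prod>k = 1..n. \<integral>\<^sup>+\<omega>. ennreal (exp (\<psi> (\<rho> ^ (n - k) * s) * (u \<bullet> real_vec (I k \<omega>)))) \<partial>\<Omega>)
      = (\<Prod>k = 1..n. \<integral>\<^sup>+\<omega>. ennreal (exp (\<psi> (\<rho> ^ (n - k) * s) * (u \<bullet> real_vec (I 1 \<omega>)))) \<partial>\<Omega>)"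
  proof (rule prod.cong[OF refl])
    fix k
    assume "k \<in> {1..n}"
    then have k: "1 \<le> k"
      by simp
    have distr: "(\<integral>\<^sup>+\<omega>. h (I l \<omega>) \<partial>\<Omega>) = (\<integral>\<^sup>+y. h y \<partial>distr \<Omega> (count_space UNIV) (I l))" if "1 \<le> l" for l and h :: "_ \<Rightarrow> ennreal"
      using measurable_immigration[OF that] by (subst nn_integral_distr) auto
    show "(\<integral>\<^sup>+\<omega>. ennreal (exp (\<psi> (\<rho> ^ (n - k) * s) * (u \<bullet> real_vec (I k \<omega>)))) \<partial>\<Omega>)
        = (\<integral>\<^sup>+\<omega>. ennreal (exp (\<psi> (\<rho> ^ (n - k) * s) * (u \<bullet> real_vec (I 1 \<omega>)))) \<partial>\<Omega>)"
      by (subst (1 2) distr) (use k immigration_law[OF k] in auto)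
  qed
  finally show ?thesis
    unfolding e_def .
qed

section \<open>Uniform exponential moments of the normalised process\<close>

theorem theorem1p4:
  fixes \<Omega> :: "'a measure"
    and P :: "2 \<Rightarrow> (nat ^ 2) pmf"
    and \<xi> :: "nat \<Rightarrow> nat \<Rightarrow> 2 \<Rightarrow> nat \<Rightarrow> 'a \<Rightarrow> nat ^ 2"
    and I :: "nat \<Rightarrow> 'a \<Rightarrow> nat ^ 2"
    and M :: "real ^ 2 ^ 2"
    and \<rho> \<theta>\<^sub>0 :: real
    and u v lam :: "real ^ 2"
    and X :: "2 \<Rightarrow> nat \<Rightarrow> 'a \<Rightarrow> nat ^ 2"
    and Y :: "2 \<Rightarrow> nat \<Rightarrow> 'a \<Rightarrow> real"
  defines "lam \<equiv> immigration_mean \<Omega> I"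
    and "X \<equiv> (\<lambda>i. immigration_X \<xi> I (unit_vec i))"
    and "Y \<equiv> (\<lambda>i. centered_Y \<rho> u lam (X i))"
  assumes "branching_with_immigration \<Omega> P \<xi> I"
    and "offspring_gf P 0 = 0"
    and "has_mean_matrix P M"
    and "positively_regular M"
    and "maximal_eigenvalue M \<rho>"
    and "perron_eigenvectors M \<rho> v u"
    and "\<rho> > 1"
    and "\<theta>\<^sub>0 > 0"
    and "\<And>i. (\<integral>\<^sup>+\<omega>. ennreal (exp (\<theta>\<^sub>0 * (1 \<bullet> real_vec (X i 1 \<omega>)))) \<partial>\<Omega>) < \<infinity>"
  shows "\<exists>\<theta>>0. \<forall>i. (SUP n. \<integral>\<^sup>+\<omega>. ennreal (exp (\<theta> * Y i n \<omega>)) \<partial>\<Omega>) < \<infinity>"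
proof -
  interpret branching_with_immigration \<Omega> P \<xi> I by fact
  have u: "\<And>i. 0 < u $ i" and Mu: "M *v u = \<rho> *s u" and u_sum: "u \<bullet> 1 = 1"
    using assms(9) by (auto simp: perron_eigenvectors_def)
  \<comment> \<open>The normalisation of \<open>u\<close> makes its weights at most 1, so the
    assumed moment of the total population dominates that of the \<open>u\<close>-weighted
    one.\<close>
  have u_le_1: "u $ i \<le> 1 $ i" for i
  proof -
    have "u $ i \<le> (\<Sum>j\<in>UNIV. u $ j)"
      using u by (intro member_le_sum) (auto simp: less_imp_le)
    then show ?thesis
      using u_sum by (simp add: inner_vec_def)
  qed
  have u_nonneg: "0 \<le> u \<bullet> real_vec x" for x
    using u by (intro inner_real_vec_nonneg less_imp_le)
  have X_1: "X i 1 \<omega> = \<xi> 0 0 i 0 \<omega> + I 1 \<omega>" for i \<omega>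
  proof -
    have "(\<Sum>j\<in>UNIV. \<Sum>m<unit_vec i $ j. \<xi> 0 0 j m \<omega>) = (\<Sum>j\<in>UNIV. if j = i then \<xi> 0 0 i 0 \<omega> else 0)"
      by (intro sum.cong) (auto simp: unit_vec_def axis_def)
    then show ?thesis
      by (simp add: X_def immigration_X_def branching_Z_def immigrant_U_def)
  qed
  \<comment> \<open>Generation 1 is one offspring vector plus one immigration vector. Each is
    controlled by the moment of the sum, because the other contributes a nonnegative amount.\<close>
  have exp_le: "exp (\<theta>\<^sub>0 * (u \<bullet> real_vec x)) \<le> exp (\<theta>\<^sub>0 * (1 \<bullet> real_vec (x + y)))"
    "exp (\<theta>\<^sub>0 * (u \<bullet> real_vec y)) \<le> exp (\<theta>\<^sub>0 * (1 \<bullet> real_vec (x + y)))" for x y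
    using inner_real_vec_mono[of u 1 x] inner_real_vec_mono[of u 1 y] u_le_1
      inner_real_vec_nonneg[of 1 x] inner_real_vec_nonneg[of 1 y] \<open>\<theta>\<^sub>0 > 0\<close>
    by (auto simp: real_vec_add inner_add_right)
  have offspring_moment: "(\<integral>\<^sup>+y. ennreal (exp (\<theta>\<^sub>0 * (u \<bullet> real_vec y))) \<partial>P i) < \<infinity>" for i
  proof -
    have "\<xi> 0 0 i 0 \<in> \<Omega> \<rightarrow>\<^sub>M count_space UNIV"
      using independent by (auto simp: indep_vars_def dest!: bspec[of _ _ "Inl (0, 0, i, 0)"])
    then have "(\<integral>\<^sup>+y. ennreal (exp (\<theta>\<^sub>0 * (u \<bullet> real_vec y))) \<partial>P i)
        = (\<integral>\<^sup>+\<omega>. ennreal (exp (\<theta>\<^sub>0 * (u \<bullet> real_vec (\<xi> 0 0 i 0 \<omega>)))) \<partial>\<Omega>)"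
      unfolding offspring_law[of 0 0 i 0, symmetric] by (subst nn_integral_distr) auto
    also have "\<dots> \<le> (\<integral>\<^sup>+\<omega>. ennreal (exp (\<theta>\<^sub>0 * (1 \<bullet> real_vec (X i 1 \<omega>)))) \<partial>\<Omega>)"
      unfolding X_1 by (intro nn_integral_mono ennreal_leI exp_le)
    finally show ?thesis
      using assms(12)[of i] by (rule order.strict_trans1)
  qed
  have "(\<integral>\<^sup>+\<omega>. ennreal (exp (\<theta>\<^sub>0 * (u \<bullet> real_vec (I 1 \<omega>)))) \<partial>\<Omega>)
      \<le> (\<integral>\<^sup>+\<omega>. ennreal (exp (\<theta>\<^sub>0 * (1 \<bullet> real_vec (X 1 1 \<omega>)))) \<partial>\<Omega>)"
    unfolding X_1 by (intro nn_integral_mono ennreal_leI exp_le)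
  then have immigration_moment: "(\<integral>\<^sup>+\<omega>. ennreal (exp (\<theta>\<^sub>0 * (u \<bullet> real_vec (I 1 \<omega>)))) \<partial>\<Omega>) < \<infinity>"
    using assms(12)[of 1] by (rule order.strict_trans1)
  have I_meas: "(\<lambda>\<omega>. u \<bullet> real_vec (I 1 \<omega>)) \<in> borel_measurable \<Omega>"
    by (rule measurable_compose[OF measurable_immigration]) auto
  obtain K where K: "0 \<le> K"
    "\<And>t. 0 \<le> t \<Longrightarrow> t \<le> \<theta>\<^sub>0 \<Longrightarrow> (\<integral>\<^sup>+\<omega>. ennreal (exp (t * (u \<bullet> real_vec (I 1 \<omega>)))) \<partial>\<Omega>) \<le> ennreal (exp (K * t))"
    using exp_moment_le_exp_linear[OF I_meas \<open>\<theta>\<^sub>0 > 0\<close> immigration_moment] by blast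
  obtain C where C: "0 \<le> C" "\<And>t i. 0 \<le> t \<Longrightarrow> t \<le> \<theta>\<^sub>0 \<Longrightarrow>
      (\<integral>\<^sup>+y. ennreal (exp (t * (u \<bullet> real_vec y))) \<partial>P i) \<le> ennreal (exp (\<rho> * (t + C * t\<^sup>2) * u $ i))"
    using offspring_mgf_le[OF assms(6) Mu u _ \<open>\<theta>\<^sub>0 > 0\<close> offspring_moment] \<open>\<rho> > 1\<close> by auto
  obtain B \<theta> where B: "0 \<le> B" and \<theta>: "0 < \<theta>" "B * \<theta> \<le> 1" "2 * \<theta> \<le> \<theta>\<^sub>0"
    and step: "\<And>s. 0 \<le> s \<Longrightarrow> s \<le> \<theta> \<Longrightarrow>
      \<rho> * (s + B * s\<^sup>2 + C * (s + B * s\<^sup>2)\<^sup>2) \<le> \<rho> * s + B * (\<rho> * s)\<^sup>2"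
    using exp_supersolution[OF C(1) \<open>\<theta>\<^sub>0 > 0\<close> \<open>\<rho> > 1\<close>] by blast
  define \<psi> where "\<psi> s = s + B * s\<^sup>2" for s
  have \<psi>: "0 \<le> \<psi> s" "s \<le> \<psi> s" "\<psi> s \<le> 2 * s" "\<psi> s \<le> \<theta>\<^sub>0" if "0 \<le> s" "s \<le> \<theta>" for s
  proof -
    have "B * s \<le> 1"
      using \<theta>(2) mult_left_mono[OF that(2) B] by simp
    then have "B * s * s \<le> 1 * s"
      using that by (intro mult_right_mono)
    then show "\<psi> s \<le> 2 * s" "\<psi> s \<le> \<theta>\<^sub>0"
      using that \<theta>(3) by (auto simp: \<psi>_def power2_eq_square mult.assoc)
  qed (use that B in \<open>auto simp: \<psi>_def\<close>)
  \<comment> \<open>The offspring bound is taken at \<open>t = \<psi> s\<close>, which is admissible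
    by \<open>\<psi> s \<le> \<theta>\<^sub>0\<close>; the inequality \<open>step\<close> then
    absorbs its quadratic error.\<close>
  have mgf: "(\<integral>\<^sup>+y. ennreal (exp (\<psi> s * (u \<bullet> real_vec y))) \<partial>P i) \<le> ennreal (exp (\<psi> (\<rho> * s) * u $ i))"
    if "0 \<le> s" "\<rho> * s \<le> \<theta>" for s i
  proof -
    have "1 * s \<le> \<rho> * s"
      using that \<open>\<rho> > 1\<close> by (intro mult_right_mono) auto
    then have s: "s \<le> \<theta>"
      using that by simp
    have "(\<integral>\<^sup>+y. ennreal (exp (\<psi> s * (u \<bullet> real_vec y))) \<partial>P i)
        \<le> ennreal (exp (\<rho> * (\<psi> s + C * (\<psi> s)\<^sup>2) * u $ i))"
      using \<psi>[OF that(1) s] by (intro C(2))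
    also have "\<dots> \<le> ennreal (exp (\<psi> (\<rho> * s) * u $ i))"
      using step[OF that(1) s] u[of i] by (intro ennreal_leI) (auto simp: \<psi>_def)
    finally show ?thesis .
  qed
  \<comment> \<open>The maximum with 1 lets one constant cover both the immigrants, whose rate is
    \<open>K\<close>, and the initial particle, whose weight \<open>u $ i\<close> is at most 1; the
    factor 2 comes from \<open>\<psi> s \<le> 2 * s\<close>.\<close>
  define K' where "K' = 2 * \<theta> * max 1 K"
  define R where "R = exp (K' * (1 / (1 - 1 / \<rho>)))"
  have "(\<integral>\<^sup>+\<omega>. ennreal (exp (\<theta> * Y i n \<omega>)) \<partial>\<Omega>) \<le> ennreal R" for i n
  proof -
    \<comment> \<open>This is the coefficient of the \<open>u\<close>-weighted population in
      \<open>\<theta> * Y i n\<close>; after \<open>n\<close> generations back it has grown exactly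
      to \<open>\<theta>\<close>.\<close>
    define s where "s = \<theta> / \<rho> ^ n"
    have s: "0 \<le> s" "\<rho> ^ n * s = \<theta>" "s \<le> \<theta>"
      using \<theta> \<open>\<rho> > 1\<close> by (auto simp: s_def field_simps)
    have s_k: "\<rho> ^ (n - k) * s = \<theta> * (1 / \<rho>) ^ k" if "k \<le> n" for k
      using that \<open>\<rho> > 1\<close> by (simp add: s_def power_diff field_simps)
    have bound: "\<psi> (\<theta> * (1 / \<rho>) ^ k) \<le> 2 * \<theta> * (1 / \<rho>) ^ k"
      "0 \<le> \<psi> (\<theta> * (1 / \<rho>) ^ k)" "\<psi> (\<theta> * (1 / \<rho>) ^ k) \<le> \<theta>\<^sub>0" for k
    proof -
      have "(1 / \<rho>) ^ k \<le> 1" "0 \<le> (1 / \<rho>) ^ k"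
        using \<open>\<rho> > 1\<close> by (auto intro!: power_le_one)
      then have "\<theta> * (1 / \<rho>) ^ k \<le> \<theta>" "0 \<le> \<theta> * (1 / \<rho>) ^ k"
        using \<theta>(1) mult_left_mono[of "(1 / \<rho>) ^ k" 1 \<theta>] by auto
      then show "\<psi> (\<theta> * (1 / \<rho>) ^ k) \<le> 2 * \<theta> * (1 / \<rho>) ^ k"
        "0 \<le> \<psi> (\<theta> * (1 / \<rho>) ^ k)" "\<psi> (\<theta> * (1 / \<rho>) ^ k) \<le> \<theta>\<^sub>0"
        using \<psi>[of "\<theta> * (1 / \<rho>) ^ k"] by auto
    qed
    have "exp (\<theta> * Y i n \<omega>) \<le> exp (\<psi> s * (u \<bullet> real_vec (X i n \<omega>)))" for \<omega>
    proof -
      have "0 \<le> u \<bullet> lam"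
        using u by (auto simp: lam_def immigration_mean_def inner_vec_def less_imp_le
            intro!: sum_nonneg mult_nonneg_nonneg)
      moreover have "1 \<le> \<rho> ^ (n + 1)"
        using \<open>\<rho> > 1\<close> by (intro one_le_power) auto
      ultimately have "0 \<le> s * ((\<rho> ^ (n + 1) - 1) / (\<rho> - 1) * (u \<bullet> lam))"
        using \<open>\<rho> > 1\<close> s(1) by (intro mult_nonneg_nonneg divide_nonneg_nonneg) auto
      moreover have "\<theta> * Y i n \<omega> = s * (u \<bullet> real_vec (X i n \<omega>)) - s * ((\<rho> ^ (n + 1) - 1) / (\<rho> - 1) * (u \<bullet> lam))"
        unfolding Y_def centered_Y_def s_def right_diff_distrib[symmetric] by simp
      moreover have "s * (u \<bullet> real_vec (X i n \<omega>)) \<le> \<psi> s * (u \<bullet> real_vec (X i n \<omega>))"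
        using \<psi>(2)[OF s(1,3)] u_nonneg by (intro mult_right_mono)
      ultimately show ?thesis
        by simp
    qed
    then have "(\<integral>\<^sup>+\<omega>. ennreal (exp (\<theta> * Y i n \<omega>)) \<partial>\<Omega>)
        \<le> (\<integral>\<^sup>+\<omega>. ennreal (exp (\<psi> s * (u \<bullet> real_vec (X i n \<omega>)))) \<partial>\<Omega>)"
      by (intro nn_integral_mono ennreal_leI)
    also have "\<dots> \<le> ennreal (exp (\<psi> (\<rho> ^ n * s) * (u \<bullet> real_vec (unit_vec i))))
        * (\<Prod>k = 1..n. \<integral>\<^sup>+\<omega>. ennreal (exp (\<psi> (\<rho> ^ (n - k) * s) * (u \<bullet> real_vec (I 1 \<omega>)))) \<partial>\<Omega>)"
      unfolding X_def using \<open>\<rho> > 1\<close> s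
      by (intro nn_integral_exp_immigration_X_le[where \<theta> = \<theta>] mgf) auto
    \<comment> \<open>The bound for the initial particle is written with the power 0 so that it
      becomes the term \<open>k = 0\<close> of the same geometric series.\<close>
    also have "\<dots> \<le> ennreal (exp (K' * (1 / \<rho>) ^ 0)) * (\<Prod>k = 1..n. ennreal (exp (K' * (1 / \<rho>) ^ k)))"
    proof (rule mult_mono)
      have "\<psi> \<theta> * u $ i \<le> (2 * \<theta>) * 1"
        using \<psi>[of \<theta>] u_le_1[of i] u[of i] \<theta>(1) by (intro mult_mono) auto
      also have "\<dots> \<le> K'"
        unfolding K'_def using \<theta>(1) by (intro mult_left_mono) auto
      finally show "ennreal (exp (\<psi> (\<rho> ^ n * s) * (u \<bullet> real_vec (unit_vec i))))
          \<le> ennreal (exp (K' * (1 / \<rho>) ^ 0))"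
        by (simp add: s(2) inner_real_vec_unit_vec ennreal_leI)
      have factor: "(\<integral>\<^sup>+\<omega>. ennreal (exp (\<psi> (\<rho> ^ (n - k) * s) * (u \<bullet> real_vec (I 1 \<omega>)))) \<partial>\<Omega>)
          \<le> ennreal (exp (K' * (1 / \<rho>) ^ k))" if "k \<in> {1..n}" for k
      proof -
        have "(\<integral>\<^sup>+\<omega>. ennreal (exp (\<psi> (\<rho> ^ (n - k) * s) * (u \<bullet> real_vec (I 1 \<omega>)))) \<partial>\<Omega>)
            \<le> ennreal (exp (K * \<psi> (\<theta> * (1 / \<rho>) ^ k)))"
          using that bound[of k] K(2)[of "\<psi> (\<theta> * (1 / \<rho>) ^ k)"] by (simp add: s_k)
        also have "K * \<psi> (\<theta> * (1 / \<rho>) ^ k) \<le> max 1 K * (2 * \<theta> * (1 / \<rho>) ^ k)"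
          using bound[of k] K(1) by (intro mult_mono) auto
        also have "\<dots> = K' * (1 / \<rho>) ^ k"
          by (simp add: K'_def)
        finally show ?thesis
          by (simp add: ennreal_leI)
      qed
      show "(\<Prod>k = 1..n. \<integral>\<^sup>+\<omega>. ennreal (exp (\<psi> (\<rho> ^ (n - k) * s) * (u \<bullet> real_vec (I 1 \<omega>)))) \<partial>\<Omega>)
          \<le> (\<Prod>k = 1..n. ennreal (exp (K' * (1 / \<rho>) ^ k)))"
        using factor by (intro prod_mono_ennreal)
    qed auto
    also have "\<dots> = (\<Prod>k = 0..n. ennreal (exp (K' * (1 / \<rho>) ^ k)))"
      by (simp add: prod.atLeast_Suc_atMost)
    also have "\<dots> = ennreal (exp (K' * (\<Sum>k = 0..n. (1 / \<rho>) ^ k)))"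
      by (simp add: prod_ennreal sum_distrib_left exp_sum)
    also have "\<dots> \<le> ennreal R"
    proof -
      have "(\<Sum>k = 0..n. (1 / \<rho>) ^ k) \<le> (\<Sum>k. (1 / \<rho>) ^ k)"
        using \<open>\<rho> > 1\<close> by (intro sum_le_suminf summable_geometric) auto
      also have "\<dots> = 1 / (1 - 1 / \<rho>)"
        using \<open>\<rho> > 1\<close> by (intro suminf_geometric) auto
      finally have "K' * (\<Sum>k = 0..n. (1 / \<rho>) ^ k) \<le> K' * (1 / (1 - 1 / \<rho>))"
        using \<theta>(1) by (intro mult_left_mono) (auto simp: K'_def)
      then show ?thesis
        by (simp add: R_def ennreal_leI)
    qed
    finally show ?thesis .
  qed
  then have "(SUP n. \<integral>\<^sup>+\<omega>. ennreal (exp (\<theta> * Y i n \<omega>)) \<partial>\<Omega>) \<le> ennreal R" for i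
    by (intro SUP_least)
  then have "(SUP n. \<integral>\<^sup>+\<omega>. ennreal (exp (\<theta> * Y i n \<omega>)) \<partial>\<Omega>) < \<infinity>" for i
    by (rule order.strict_trans1) simp
  then show ?thesis
    using \<theta>(1) by blast
qed

end
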